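(* For any $\rho>1$ there exist $\varepsilon_0=\varepsilon_0(\rho)>0$, $d_0=d_0(\rho)>0$ and $c=c(\rho)<\infty$ such that the following holds. Let $(f_1,W_1)$ and $(f_2,W_2)$ be radial ($\mathbb{D}$-)Loewner pairs, let $T<\infty$, and suppose that $$\sup_{t\in[0,T]}|W_1(t)-W_2(t)|\le\varepsilon,$$ where $\varepsilon<\varepsilon_0$. Then for any $z_1,z_2\in\mathbb{D}$ with $|z_1-z_2|\le\varepsilon$ and $|z_1|,|z_2|\le 1-d$, where $(4\varepsilon)^{1/\rho}\le d\le d_0$, $$|f_1(T,z_1)-f_2(T,z_2)|\le c\,\varepsilon\,d^{-\rho}.$$
   Context: A $\mathbb{D}$-Loewner pair $(f,W)$ consists of a continuous function $W:[0,\infty)\to\partial\mathbb{D}$ and the solution $f(t,z)$ of the radial Loewner equation $$\partial_t f(t,z)=-z\,\partial_z f(t,z)\,\frac{W(t)+z}{W(t)-z},\qquad f(0,z)=z,\ z\in\mathbb{D}.$$ *)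

theory Defs
  imports "HOL-Complex_Analysis.Complex_Analysis"
begin

text \<open>
  A radial Loewner pair \<open>(f, W)\<close> on the unit disc.  The equation
  \<open>\<partial>\<^sub>t f(t,z) = - z \<partial>\<^sub>z f(t,z) (W(t) + z) / (W(t) - z)\<close> is understood in the classical sense:
  \<open>\<partial>\<^sub>z\<close> is the complex derivative, and \<open>f\<close> is a \<open>C\<^sup>1\<close> function of \<open>(t, z)\<close>.  Given the
  holomorphy in \<open>z\<close>, joint continuity of \<open>f\<close> is enough for the latter, since \<open>\<partial>\<^sub>z f\<close> is then
  jointly continuous by Cauchy's formula and \<open>\<partial>\<^sub>t f\<close> by the equation.  The time derivative at
  \<open>t = 0\<close> is one-sided.  Values outside \<open>t \<ge> 0\<close>, \<open>\<bar>z\<bar> < 1\<close> are irrelevant.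
\<close>

definition radial_Loewner_pair ::
    "(real \<Rightarrow> complex \<Rightarrow> complex) \<Rightarrow> (real \<Rightarrow> complex) \<Rightarrow> bool" where
  "radial_Loewner_pair f W \<longleftrightarrow>
     continuous_on {0..} W \<and> W ` {0..} \<subseteq> sphere 0 1 \<and>
     continuous_on ({0..} \<times> ball 0 1) (\<lambda>(t, z). f t z) \<and>
     (\<forall>t\<ge>0. f t holomorphic_on ball 0 1) \<and>
     (\<forall>z\<in>ball 0 1. f 0 z = z) \<and>
     (\<forall>t\<ge>0. \<forall>z\<in>ball 0 1.
        ((\<lambda>s. f s z) has_vector_derivative
           - z * deriv (f t) z * ((W t + z) / (W t - z))) (at t within {0..}))"

end

theory Submission
  imports Defs
begin

text \<open>
  The equation is a transport equation, so \<open>f(T,z)\<close> is the time-\<open>T\<close> value of the flow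
  \<open>h' = - h (w + h) / (w - h)\<close>, \<open>h(0) = z\<close>, whose driving function \<open>w(s) = W(T - s)\<close> is run
  backwards: \<open>f(T - s, h(s))\<close> has derivative zero (\<open>radial_Loewner_pair_eq_reverse_flow\<close>).  The flow
  points inwards, hence stays in a compact subset of the disc, where its field is Lipschitz, and
  exists for all times (\<open>reverse_flow_exists\<close>).

  It remains to compare two such flows \<open>h\<^sub>1, h\<^sub>2\<close> with drivers at distance at most \<open>\<epsilon>\<close>.  Put
  \<open>q\<^sub>i = \<bar>h\<^sub>i\<bar>\<^sup>2 / \<bar>w\<^sub>i - h\<^sub>i\<bar>\<^sup>2\<close>.  On the one hand \<open>2 q\<^sub>i\<close> is exactly the logarithmic derivative of the
  gap \<open>1 - \<bar>h\<^sub>i\<bar>\<^sup>2\<close>.  On the other hand a two-point version of the infinitesimal Schwarz-Pick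
  inequality (\<open>two_point_Schwarz_Pick\<close>) shows that \<open>\<bar>h\<^sub>1 - h\<^sub>2\<bar>\<close> grows at rate at most
  \<open>(q\<^sub>1 + q\<^sub>2) (\<bar>h\<^sub>1 - h\<^sub>2\<bar> + \<epsilon>)\<close>: the multiplicative part and the part forced by the drivers are
  controlled by the same quantity.  Consequently
  \<open>(\<bar>h\<^sub>1 - h\<^sub>2\<bar> + \<epsilon>) / sqrt ((1 - \<bar>h\<^sub>1\<bar>\<^sup>2) (1 - \<bar>h\<^sub>2\<bar>\<^sup>2))\<close> is nonincreasing along the flow
  (\<open>loewner_flow_stability\<close>).  At time \<open>0\<close> the numerator is at most \<open>2 \<epsilon>\<close> and the denominator at
  least \<open>d\<close>, at time \<open>T\<close> the denominator is at most \<open>1\<close>, so the distance of the images is at most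
  \<open>2 \<epsilon> / d\<close>, which for \<open>d \<le> 1\<close> and \<open>\<rho> > 1\<close> is at most \<open>2 \<epsilon> d\<^bsup>-\<rho>\<^esup>\<close>.
\<close>

section \<open>The vector field of the reverse flow\<close>

definition loewner_field :: "complex \<Rightarrow> complex \<Rightarrow> complex" where
  "loewner_field w z = - z * ((w + z) / (w - z))"

lemma Re_Herglotz_kernel:
  assumes "norm w = 1"
  shows "Re ((w + z) / (w - z)) = (1 - (norm z)\<^sup>2) / (norm (w - z))\<^sup>2"
proof -
  have w: "(Re w)\<^sup>2 + (Im w)\<^sup>2 = 1"
    using assms by (simp flip: cmod_power2)
  show ?thesis
    unfolding Re_divide cmod_power2
    by (rule arg_cong2[where f = "(/)"]) (use w in \<open>auto simp: power2_eq_square algebra_simps\<close>)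
qed

lemma inner_self_mult:
  fixes z u :: complex
  shows "inner z (z * u) = (norm z)\<^sup>2 * Re u"
  unfolding inner_complex_def cmod_power2 by (simp add: power2_eq_square algebra_simps)

text \<open>
  The real part of \<open>(w + z) / (w - z)\<close> is the Poisson kernel, so inside the disc the field points
  inwards, with a radial component proportional to the gap \<open>1 - \<bar>z\<bar>\<^sup>2\<close>.  That factor is what makes
  the logarithm of the gap evolve at the rate \<open>2 \<bar>z\<bar>\<^sup>2 / \<bar>w - z\<bar>\<^sup>2\<close>.
\<close>

lemma inner_loewner_field:
  assumes "norm w = 1"
  shows "inner z (loewner_field w z) = - ((norm z)\<^sup>2 * (1 - (norm z)\<^sup>2) / (norm (w - z))\<^sup>2)"
proof -
  have "inner z (loewner_field w z) = inner z (z * (- ((w + z) / (w - z))))"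
    by (simp add: loewner_field_def)
  then show ?thesis
    unfolding inner_self_mult using Re_Herglotz_kernel[OF assms, of z] by simp
qed

text \<open>
  Since \<open>(w + z) / (w - z) = 2 w / (w - z) - 1\<close>, the only nonlinear term of the field is
  \<open>w z / (w - z)\<close>, and its increment splits into a multiple of \<open>z\<^sub>1 - z\<^sub>2\<close> and a multiple of
  \<open>w\<^sub>1 - w\<^sub>2\<close>.
\<close>

lemma loewner_field_diff:
  assumes "w\<^sub>1 \<noteq> z\<^sub>1" "w\<^sub>2 \<noteq> z\<^sub>2"
  shows "loewner_field w\<^sub>1 z\<^sub>1 - loewner_field w\<^sub>2 z\<^sub>2 =
    (z\<^sub>1 - z\<^sub>2) * (1 - 2 * (w\<^sub>1 / (w\<^sub>1 - z\<^sub>1)) * (w\<^sub>2 / (w\<^sub>2 - z\<^sub>2))) +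
    2 * (z\<^sub>1 / (w\<^sub>1 - z\<^sub>1)) * (z\<^sub>2 / (w\<^sub>2 - z\<^sub>2)) * (w\<^sub>1 - w\<^sub>2)"
  using assms unfolding loewner_field_def
  by (simp add: divide_simps) (simp add: algebra_simps)

text \<open>
  The difference of the two sides is \<open>\<bar>a + cnj b - 1\<bar>\<^sup>2\<close>.  It is applied to
  \<open>a = w\<^sub>1 / (w\<^sub>1 - z\<^sub>1)\<close> and \<open>b = w\<^sub>2 / (w\<^sub>2 - z\<^sub>2)\<close>, for which \<open>a - 1 = z\<^sub>1 / (w\<^sub>1 - z\<^sub>1)\<close> and
  \<open>b - 1 = z\<^sub>2 / (w\<^sub>2 - z\<^sub>2)\<close>.  In the confluent case \<open>a = b\<close> it says that the reverse flow does
  not increase hyperbolic length.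
\<close>

lemma two_point_Schwarz_Pick:
  fixes a b :: complex
  shows "Re (1 - 2 * a * b) \<le> (norm (a - 1))\<^sup>2 + (norm (b - 1))\<^sup>2"
proof -
  have "(norm (a - 1))\<^sup>2 + (norm (b - 1))\<^sup>2 - Re (1 - 2 * a * b) = (norm (a + cnj b - 1))\<^sup>2"
    unfolding cmod_power2 by (simp add: power2_eq_square algebra_simps)
  then show ?thesis
    by (smt (verit) zero_le_power2)
qed

text \<open>
  Both parts of the increment are bounded through the same weight: the first by
  \<open>two_point_Schwarz_Pick\<close>, the second because \<open>2 x y \<le> x\<^sup>2 + y\<^sup>2\<close>.
\<close>

lemma inner_loewner_field_diff_le:
  assumes "norm w\<^sub>1 = 1" "norm w\<^sub>2 = 1" "norm z\<^sub>1 < 1" "norm z\<^sub>2 < 1" "norm (w\<^sub>1 - w\<^sub>2) \<le> \<epsilon>"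
  shows "inner (z\<^sub>1 - z\<^sub>2) (loewner_field w\<^sub>1 z\<^sub>1 - loewner_field w\<^sub>2 z\<^sub>2) \<le>
    norm (z\<^sub>1 - z\<^sub>2) * (norm (z\<^sub>1 - z\<^sub>2) + \<epsilon>) *
    ((norm z\<^sub>1)\<^sup>2 / (norm (w\<^sub>1 - z\<^sub>1))\<^sup>2 + (norm z\<^sub>2)\<^sup>2 / (norm (w\<^sub>2 - z\<^sub>2))\<^sup>2)"
proof -
  define a b p r where "a = w\<^sub>1 / (w\<^sub>1 - z\<^sub>1)" and "b = w\<^sub>2 / (w\<^sub>2 - z\<^sub>2)"
    and "p = z\<^sub>1 / (w\<^sub>1 - z\<^sub>1)" and "r = z\<^sub>2 / (w\<^sub>2 - z\<^sub>2)"
  define q where "q = (norm p)\<^sup>2 + (norm r)\<^sup>2"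
  have ne: "w\<^sub>1 \<noteq> z\<^sub>1" "w\<^sub>2 \<noteq> z\<^sub>2"
    using assms by auto
  have ab: "a - 1 = p" "b - 1 = r"
    using ne by (auto simp: a_def b_def p_def r_def field_simps)
  have "inner (z\<^sub>1 - z\<^sub>2) (loewner_field w\<^sub>1 z\<^sub>1 - loewner_field w\<^sub>2 z\<^sub>2) =
      (norm (z\<^sub>1 - z\<^sub>2))\<^sup>2 * Re (1 - 2 * a * b) + inner (z\<^sub>1 - z\<^sub>2) (2 * p * r * (w\<^sub>1 - w\<^sub>2))"
    by (simp only: loewner_field_diff[OF ne] inner_add_right inner_self_mult a_def b_def p_def r_def)
  also have "\<dots> \<le> (norm (z\<^sub>1 - z\<^sub>2))\<^sup>2 * q + norm (z\<^sub>1 - z\<^sub>2) * (\<epsilon> * q)"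
  proof (rule add_mono)
    show "(norm (z\<^sub>1 - z\<^sub>2))\<^sup>2 * Re (1 - 2 * a * b) \<le> (norm (z\<^sub>1 - z\<^sub>2))\<^sup>2 * q"
      using two_point_Schwarz_Pick[of a b] by (intro mult_left_mono) (auto simp: q_def ab)
    have "norm (2 * p * r * (w\<^sub>1 - w\<^sub>2)) = (2 * norm p * norm r) * norm (w\<^sub>1 - w\<^sub>2)"
      by (simp add: norm_mult)
    also have "\<dots> \<le> q * \<epsilon>"
      using assms(5) sum_squares_bound[of "norm p" "norm r"]
      by (intro mult_mono) (auto simp: q_def)
    finally have "norm (2 * p * r * (w\<^sub>1 - w\<^sub>2)) \<le> \<epsilon> * q"
      by (simp add: mult.commute)
    then show "inner (z\<^sub>1 - z\<^sub>2) (2 * p * r * (w\<^sub>1 - w\<^sub>2)) \<le> norm (z\<^sub>1 - z\<^sub>2) * (\<epsilon> * q)"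
      by (meson norm_cauchy_schwarz mult_left_mono norm_ge_zero order_trans)
  qed
  finally show ?thesis
    by (simp add: q_def p_def r_def norm_divide power_divide power2_eq_square algebra_simps)
qed

lemma loewner_field_lipschitz:
  assumes "norm w = 1" "norm z\<^sub>1 \<le> r" "norm z\<^sub>2 \<le> r" "r < 1"
  shows "norm (loewner_field w z\<^sub>1 - loewner_field w z\<^sub>2) \<le> (1 + 2 / (1 - r)\<^sup>2) * norm (z\<^sub>1 - z\<^sub>2)"
proof -
  have ne: "w \<noteq> z\<^sub>1" "w \<noteq> z\<^sub>2"
    using assms by auto
  have far: "norm (w / (w - z)) \<le> 1 / (1 - r)" if "norm z \<le> r" for z
  proof -
    have "1 - r \<le> norm (w - z)"
      using norm_triangle_ineq2[of w z] assms that by simp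
    then show ?thesis
      using assms by (simp add: norm_divide frac_le)
  qed
  have "norm (1 - 2 * (w / (w - z\<^sub>1)) * (w / (w - z\<^sub>2))) \<le>
      1 + 2 * norm (w / (w - z\<^sub>1)) * norm (w / (w - z\<^sub>2))"
    by (rule order_trans[OF norm_triangle_ineq4]) (simp add: norm_mult norm_divide)
  also have "\<dots> \<le> 1 + 2 * (1 / (1 - r)) * (1 / (1 - r))"
    using far[OF assms(2)] far[OF assms(3)] assms(4)
    by (intro add_left_mono mult_mono) auto
  finally have "norm (1 - 2 * (w / (w - z\<^sub>1)) * (w / (w - z\<^sub>2))) \<le> 1 + 2 / (1 - r)\<^sup>2"
    by (simp add: power2_eq_square)
  from mult_left_mono[OF this norm_ge_zero[of "z\<^sub>1 - z\<^sub>2"]] show ?thesis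
    unfolding loewner_field_diff[OF ne] by (simp add: norm_mult mult.commute)
qed

section \<open>Flows of Lipschitz vector fields\<close>

lemma antimono_of_nonpos_derivative:
  fixes g :: "real \<Rightarrow> real"
  assumes "a \<le> b"
    and "\<And>s. s \<in> {a..b} \<Longrightarrow> (g has_real_derivative g' s) (at s within {a..b})"
    and "\<And>s. s \<in> {a..b} \<Longrightarrow> g' s \<le> 0"
  shows "g b \<le> g a"
proof (rule DERIV_nonpos_imp_decreasing_open[OF assms(1)])
  show "continuous_on {a..b} g"
    using assms(2) by (rule DERIV_continuous_on)
  fix s assume s: "a < s" "s < b"
  then have "(g has_real_derivative g' s) (at s)"
    using assms(2)[of s] by (simp add: at_within_Icc_at)
  then show "\<exists>y. DERIV g s :> y \<and> y \<le> 0"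
    using assms(3)[of s] s by auto
qed

text \<open>
  The Picard operator contracts the norm \<open>sup\<^sub>s e\<^bsup>-L s\<^esup> \<bar>h(s)\<bar>\<close> with \<open>L = 2 K\<close> by the factor
  \<open>1/2\<close>, since \<open>K \<integral>\<^sub>0\<^sup>s e\<^bsup>L x\<^esup> dx \<le> (K / L) e\<^bsup>L s\<^esup>\<close>; hence one application of the
  Banach fixed point theorem covers the whole interval.  The argument is carried out for
  \<open>g(s) = e\<^bsup>-L s\<^esup> h(s)\<close>, so that the weighted norm becomes the ordinary supremum norm.
\<close>

lemma global_lipschitz_ode_solution:
  fixes F :: "real \<Rightarrow> 'a::{euclidean_space} \<Rightarrow> 'a"
  assumes "T \<ge> 0" "K > 0"
    and cont: "continuous_on ({0..T} \<times> UNIV) (\<lambda>(s, x). F s x)"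
    and lip: "\<And>s x y. s \<in> {0..T} \<Longrightarrow> norm (F s x - F s y) \<le> K * norm (x - y)"
  obtains h where "h 0 = x\<^sub>0"
    "\<And>s. s \<in> {0..T} \<Longrightarrow> (h has_vector_derivative F s (h s)) (at s within {0..T})"
proof -
  define L where "L = 2 * K"
  have L: "L > 0"
    using assms by (simp add: L_def)
  define V where "V g s = F s (exp (L * s) *\<^sub>R apply_bcontfun g s)" for g :: "real \<Rightarrow>\<^sub>C 'a" and s
  define P where "P g s = exp (- L * s) *\<^sub>R (x\<^sub>0 + integral {0..s} (V g))" for g s
  \<comment> \<open>Clamping the time to \<open>[0, T]\<close> extends functions on the interval to bounded continuous functions on the line.\<close>
  define c where "c s = max 0 (min T s)" for s
  have c: "c s \<in> {0..T}" for s
    using assms(1) by (auto simp: c_def)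
  have c_id: "c s = s" if "s \<in> {0..T}" for s
    using that by (auto simp: c_def)
  have contV: "continuous_on {0..T} (V g)" for g
  proof -
    have "continuous_on {0..T} ((\<lambda>(s, x). F s x) \<circ> (\<lambda>s. (s, exp (L * s) *\<^sub>R apply_bcontfun g s)))"
      by (intro continuous_on_compose continuous_on_subset[OF cont] continuous_intros) auto
    then show ?thesis
      by (simp add: V_def[abs_def] o_def)
  qed
  have intV: "V g integrable_on {0..s}" if "s \<in> {0..T}" for g s
    using that by (intro integrable_continuous_real continuous_on_subset[OF contV]) auto
  have contP: "continuous_on {0..T} (P g)" for g
    unfolding P_def
    by (intro continuous_intros indefinite_integral_continuous_1 intV) (use assms(1) in auto)
  have Pc: "(\<lambda>s. P g (c s)) \<in> bcontfun" for g
  proof -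
    have "continuous_on UNIV (P g \<circ> c)"
      by (intro continuous_on_compose continuous_on_subset[OF contP])
        (use c in \<open>auto simp: c_def[abs_def] intro!: continuous_intros\<close>)
    moreover have "bounded (range (\<lambda>s. P g (c s)))"
      by (rule bounded_subset[OF compact_imp_bounded[OF compact_continuous_image[OF contP[of g] compact_Icc]]])
        (use c in auto)
    ultimately show ?thesis
      by (simp add: bcontfun_def o_def)
  qed
  define \<Phi> where "\<Phi> g = Bcontfun (\<lambda>s. P g (c s))" for g
  have app: "apply_bcontfun (\<Phi> g) s = P g (c s)" for g s
    using Pc[of g] by (simp add: \<Phi>_def Bcontfun_inverse)
  have contraction: "dist (\<Phi> g) (\<Phi> k) \<le> 1 / 2 * dist g k" for g k
  proof (rule dist_bound)
    fix s'
    define s where "s = c s'"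
    define D where "D = dist g k"
    have s: "s \<in> {0..T}"
      using c by (simp add: s_def)
    have exp_int: "((\<lambda>x. K * D * exp (L * x)) has_integral
        (K * D / L * exp (L * s) - K * D / L * exp (L * 0))) {0..s}"
      by (rule fundamental_theorem_of_calculus)
        (use s L in \<open>auto intro!: derivative_eq_intros simp flip: has_real_derivative_iff_has_vector_derivative\<close>)
    have "norm (integral {0..s} (\<lambda>x. V g x - V k x)) \<le> integral {0..s} (\<lambda>x. K * D * exp (L * x))"
    proof (rule integral_norm_bound_integral)
      show "(\<lambda>x. V g x - V k x) integrable_on {0..s}"
        by (intro integrable_diff intV s)
      show "(\<lambda>x. K * D * exp (L * x)) integrable_on {0..s}"
        using exp_int by blast
      fix x assume "x \<in> {0..s}"
      then have "norm (V g x - V k x) \<le> K * norm (exp (L * x) *\<^sub>R apply_bcontfun g x - exp (L * x) *\<^sub>R apply_bcontfun k x)"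
        unfolding V_def using s by (intro lip) auto
      also have "\<dots> = K * dist (apply_bcontfun g x) (apply_bcontfun k x) * exp (L * x)"
        by (simp add: dist_norm flip: scaleR_diff_right)
      also have "\<dots> \<le> K * D * exp (L * x)"
        using dist_bounded[of g x k] assms(2) by (intro mult_right_mono mult_left_mono) (auto simp: D_def)
      finally show "norm (V g x - V k x) \<le> K * D * exp (L * x)" .
    qed
    also have "\<dots> = K * D / L * exp (L * s) - K * D / L"
      unfolding integral_unique[OF exp_int] by simp
    also have "\<dots> \<le> D / 2 * exp (L * s)"
      using assms(2) by (simp add: L_def D_def)
    finally have int: "norm (integral {0..s} (V g) - integral {0..s} (V k)) \<le> D / 2 * exp (L * s)"
      by (simp add: Henstock_Kurzweil_Integration.integral_diff[OF intV[OF s] intV[OF s]])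
    have "dist (P g s) (P k s) = exp (- L * s) * norm (integral {0..s} (V g) - integral {0..s} (V k))"
      by (simp add: P_def dist_norm flip: scaleR_diff_right)
    also have "\<dots> \<le> exp (- L * s) * (D / 2 * exp (L * s))"
      using int by (intro mult_left_mono) auto
    also have "\<dots> = 1 / 2 * D"
      by (simp add: exp_minus)
    finally show "dist (apply_bcontfun (\<Phi> g) s') (apply_bcontfun (\<Phi> k) s') \<le> 1 / 2 * dist g k"
      by (simp add: app s_def D_def)
  qed
  have "\<exists>!g. \<Phi> g = g"
    using contraction by (intro banach_fix_type[of "1/2"]) auto
  then obtain g where g: "\<Phi> g = g"
    by blast
  define h where "h s = x\<^sub>0 + integral {0..s} (V g)" for s
  have gh: "exp (L * s) *\<^sub>R apply_bcontfun g s = h s" if "s \<in> {0..T}" for s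
  proof -
    have "apply_bcontfun g s = P g s"
      using app[of g s] c_id[OF that] by (simp add: g)
    then show ?thesis
      by (simp add: P_def h_def exp_minus)
  qed
  show ?thesis
  proof (rule that[of h])
    show "h 0 = x\<^sub>0"
      by (simp add: h_def)
    fix s assume s: "s \<in> {0..T}"
    have "(h has_vector_derivative V g s) (at s within {0..T})"
      unfolding h_def using integral_has_vector_derivative[OF contV s]
      by (auto intro!: derivative_eq_intros)
    then show "(h has_vector_derivative F s (h s)) (at s within {0..T})"
      by (simp add: V_def gh[OF s])
  qed
qed

section \<open>Existence of the reverse flow\<close>

lemma closest_point_cball_0:
  fixes x :: "'a::euclidean_space"
  assumes "r > 0" "norm x \<ge> r"
  shows "closest_point (cball 0 r) x = (r / norm x) *\<^sub>R x"
proof (rule closest_point_unique[symmetric])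
  have x: "norm x > 0"
    using assms by linarith
  show "(r / norm x) *\<^sub>R x \<in> cball 0 r"
    using assms x by simp
  have "x - (r / norm x) *\<^sub>R x = (1 - r / norm x) *\<^sub>R x"
    by (simp add: scaleR_diff_left)
  then have "dist x ((r / norm x) *\<^sub>R x) = \<bar>1 - r / norm x\<bar> * norm x"
    by (simp add: dist_norm)
  also have "\<dots> = norm x - r"
    using assms x by (simp add: abs_mult_pos field_simps)
  finally show "\<forall>z\<in>cball 0 r. dist x ((r / norm x) *\<^sub>R x) \<le> dist x z"
    by (smt (verit) dist_norm mem_cball_0 norm_triangle_ineq2)
qed auto

lemma has_real_derivative_norm_power2:
  fixes h :: "real \<Rightarrow> 'a::real_inner"
  assumes "(h has_vector_derivative h') (at s within S)"
  shows "((\<lambda>s. (norm (h s))\<^sup>2) has_real_derivative 2 * inner (h s) h') (at s within S)"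
proof -
  have h: "(h has_derivative (\<lambda>x. x *\<^sub>R h')) (at s within S)"
    using assms by (simp add: has_vector_derivative_def)
  show ?thesis
    unfolding has_field_derivative_def power2_norm_eq_inner
    by (rule has_derivative_eq_rhs[OF has_derivative_inner[OF h h]])
      (auto simp: inner_commute algebra_simps)
qed

text \<open>
  The factor \<open>1 - \<bar>h\<bar>\<^sup>2\<close> in \<open>inner_loewner_field\<close> cancels against the one that the logarithm
  produces.
\<close>

lemma has_real_derivative_ln_gap_loewner_flow:
  assumes h: "(h has_vector_derivative loewner_field w (h s)) (at s within S)"
    and "norm w = 1" "norm (h s) < 1"
  shows "((\<lambda>s. ln (1 - (norm (h s))\<^sup>2)) has_real_derivative
    2 * ((norm (h s))\<^sup>2 / (norm (w - h s))\<^sup>2)) (at s within S)"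
proof -
  have pos: "1 - (norm (h s))\<^sup>2 > 0"
    using assms(3) by (simp add: power_less_one_iff)
  have cancel: "inverse D * (0 - 2 * - (n * D / m)) = 2 * (n / m)" if "D \<noteq> 0" for D n m :: real
    using that by (simp add: divide_simps)
  have "((\<lambda>s. 1 - (norm (h s))\<^sup>2) has_real_derivative
      0 - 2 * inner (h s) (loewner_field w (h s))) (at s within S)"
    by (intro DERIV_diff DERIV_const has_real_derivative_norm_power2 h)
  from DERIV_chain2[OF DERIV_ln[OF pos] this] show ?thesis
    by (rule DERIV_cong) (use cancel[OF less_imp_neq[OF pos, symmetric]] in \<open>simp only: inner_loewner_field[OF assms(2)] less_irrefl\<close>)
qed

text \<open>
  The field is Lipschitz only away from the unit circle.  Precomposing it with the projection onto
  a smaller closed disc makes it globally Lipschitz.  The projected point is a nonnegative multiple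
  of the original one, so the truncated field still points inwards; the solution therefore never
  reaches the region where the truncation acts.
\<close>

lemma reverse_flow_exists:
  fixes V :: "real \<Rightarrow> complex"
  assumes "T \<ge> 0" and contV: "continuous_on {0..T} V"
    and V: "\<And>s. s \<in> {0..T} \<Longrightarrow> norm (V s) = 1" and z: "norm z < 1"
  obtains h where "h 0 = z"
    "\<And>s. s \<in> {0..T} \<Longrightarrow> norm (h s) < 1"
    "\<And>s. s \<in> {0..T} \<Longrightarrow> (h has_vector_derivative loewner_field (V s) (h s)) (at s within {0..T})"
proof -
  \<comment> \<open>Any radius in \<open>(0, 1)\<close> that is at least \<open>\<bar>z\<bar>\<close> serves; the midpoint is positive even for \<open>z = 0\<close>.\<close>
  define r where "r = (1 + norm z) / 2"
  have r: "0 < r" "r < 1" "norm z \<le> r"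
    using z by (auto simp: r_def add_pos_nonneg)
  define \<pi> where "\<pi> = closest_point (cball (0::complex) r)"
  have \<pi>_le: "norm (\<pi> x) \<le> r" for x
    using closest_point_in_set[of "cball 0 r" x] r by (simp add: \<pi>_def)
  have \<pi>_id: "\<pi> x = x" if "norm x \<le> r" for x
    using that by (simp add: \<pi>_def closest_point_self)
  have \<pi>_lip: "norm (\<pi> x - \<pi> y) \<le> norm (x - y)" for x y
    using closest_point_lipschitz[of "cball 0 r" x y] r by (simp add: \<pi>_def dist_norm)
  have \<pi>_ne: "V s - \<pi> x \<noteq> 0" if "s \<in> {0..T}" for s x
    using V[OF that] \<pi>_le[of x] r by auto
  have cont\<pi>: "continuous_on UNIV \<pi>"
    unfolding \<pi>_def using r by (intro continuous_on_closest_point) auto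
  define K where "K = 1 + 2 / (1 - r)\<^sup>2"
  have "K > 0"
    unfolding K_def by (simp add: add_pos_nonneg)
  have "continuous_on ({0..T} \<times> UNIV) (\<lambda>p. loewner_field (V (fst p)) (\<pi> (snd p)))"
    unfolding loewner_field_def
    by (intro continuous_intros continuous_on_compose2[OF contV] continuous_on_compose2[OF cont\<pi>])
      (use \<pi>_ne in auto)
  then have cont: "continuous_on ({0..T} \<times> UNIV) (\<lambda>(s, x). loewner_field (V s) (\<pi> x))"
    by (simp add: case_prod_unfold)
  have lip: "norm (loewner_field (V s) (\<pi> x) - loewner_field (V s) (\<pi> y)) \<le> K * norm (x - y)"
    if "s \<in> {0..T}" for s x y
  proof -
    have "norm (loewner_field (V s) (\<pi> x) - loewner_field (V s) (\<pi> y)) \<le> K * norm (\<pi> x - \<pi> y)"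
      unfolding K_def by (intro loewner_field_lipschitz V[OF that] \<pi>_le r)
    also have "\<dots> \<le> K * norm (x - y)"
      using \<open>K > 0\<close> \<pi>_lip by (intro mult_left_mono) auto
    finally show ?thesis .
  qed
  obtain h where h0: "h 0 = z" and
    h: "\<And>s. s \<in> {0..T} \<Longrightarrow> (h has_vector_derivative loewner_field (V s) (\<pi> (h s))) (at s within {0..T})"
    using global_lipschitz_ode_solution[OF assms(1) \<open>K > 0\<close> cont lip, of z] by blast
  have inward: "inner x (loewner_field (V s) (\<pi> x)) \<le> 0" if s: "s \<in> {0..T}" for s x
  proof -
    have le: "inner (\<pi> x) (loewner_field (V s) (\<pi> x)) \<le> 0"
      unfolding inner_loewner_field[OF V[OF s]] using \<pi>_le[of x] r
      by (simp add: power_le_one)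
    show ?thesis
    proof (cases "norm x \<le> r")
      case True
      then show ?thesis
        using le by (simp add: \<pi>_id)
    next
      case False
      then have "\<pi> x = (r / norm x) *\<^sub>R x"
        unfolding \<pi>_def using r by (intro closest_point_cball_0) auto
      then have "x = (norm x / r) *\<^sub>R \<pi> x"
        using False r by (cases "x = 0") auto
      then have "inner x (loewner_field (V s) (\<pi> x)) =
          norm x / r * inner (\<pi> x) (loewner_field (V s) (\<pi> x))"
        by (metis inner_scaleR_left)
      then show ?thesis
        using le r by (simp add: divide_nonpos_pos mult_nonneg_nonpos)
    qed
  qed
  have decr: "norm (h s) \<le> norm z" if s: "s \<in> {0..T}" for s
  proof -
    have "(norm (h s))\<^sup>2 \<le> (norm (h 0))\<^sup>2"
    proof (rule antimono_of_nonpos_derivative[where g = "\<lambda>u. (norm (h u))\<^sup>2"])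
      show "0 \<le> s"
        using s by simp
      fix u assume u: "u \<in> {0..s}"
      then show "((\<lambda>u. (norm (h u))\<^sup>2) has_real_derivative
          2 * inner (h u) (loewner_field (V u) (\<pi> (h u)))) (at u within {0..s})"
        using s by (intro has_real_derivative_norm_power2 has_vector_derivative_within_subset[OF h]) auto
      show "2 * inner (h u) (loewner_field (V u) (\<pi> (h u))) \<le> 0"
        using inward[of u "h u"] u s by auto
    qed
    then show ?thesis
      by (simp add: h0)
  qed
  show ?thesis
  proof (rule that[of h])
    show "h 0 = z"
      by (rule h0)
    fix s assume s: "s \<in> {0..T}"
    show "norm (h s) < 1"
      using decr[OF s] z by simp
    show "(h has_vector_derivative loewner_field (V s) (h s)) (at s within {0..T})"
      using h[OF s] \<pi>_id[of "h s"] decr[OF s] r by simp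
  qed
qed

section \<open>Loewner pairs are transported by the reverse flow\<close>

text \<open>
  By compactness, \<open>f s\<close> is uniformly close to \<open>f t\<close> on a closed disc around \<open>z\<close> when \<open>s\<close> is near
  \<open>t\<close>; Cauchy's inequality turns this into closeness of the derivatives on a disc of half the
  radius.
\<close>

lemma continuous_on_deriv_parametric:
  fixes f :: "'t::topological_space \<Rightarrow> complex \<Rightarrow> complex"
  assumes cont: "continuous_on (S \<times> A) (\<lambda>(t, z). f t z)" and "open A"
    and hol: "\<And>t. t \<in> S \<Longrightarrow> f t holomorphic_on A"
  shows "continuous_on (S \<times> A) (\<lambda>(t, z). deriv (f t) z)"
  unfolding continuous_on_def
proof (safe intro!: tendstoI)
  fix t z and e :: real
  assume t: "t \<in> S" and z: "z \<in> A" and e: "e > 0"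
  obtain R where R: "R > 0" "cball z R \<subseteq> A"
    using \<open>open A\<close> z open_contains_cball by blast
  define r where "r = R / 2"
  have r: "r > 0"
    using R by (simp add: r_def)
  have "continuous_on (S \<times> cball z R) (\<lambda>(t, z). f t z)"
    using R by (intro continuous_on_subset[OF cont]) auto
  then obtain X where X: "t \<in> X" "open X"
    and near: "\<forall>s\<in>X \<inter> S. \<forall>u\<in>cball z R. dist (f s u) (f t u) \<le> e / 2 * r"
    using continuous_on_prod_compactE[OF _ compact_cball t, of z R "\<lambda>(t, z). f t z" "e / 2 * r"] e r
    by auto
  have "continuous_on A (deriv (f t))"
    using hol[OF t] \<open>open A\<close> by (intro holomorphic_on_imp_continuous_on holomorphic_deriv)
  then have "isCont (deriv (f t)) z"
    using \<open>open A\<close> z by (simp add: continuous_on_eq_continuous_at)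
  then obtain k where k: "k > 0" "\<And>w. dist w z < k \<Longrightarrow> dist (deriv (f t) w) (deriv (f t) z) < e / 2"
    using e unfolding continuous_at_eps_delta by (meson half_gt_zero)
  have "dist (deriv (f s) w) (deriv (f t) z) < e"
    if s: "s \<in> X" "s \<in> S" and w: "w \<in> ball z (min r k)" for s w
  proof -
    have sub: "cball w r \<subseteq> cball z R"
    proof
      fix u assume "u \<in> cball w r"
      then show "u \<in> cball z R"
        using dist_triangle[of z u w] w by (auto simp: r_def)
    qed
    have hol_w: "f a holomorphic_on cball w r" if "a \<in> S" for a
      using holomorphic_on_subset[OF hol[OF that]] sub R by blast
    have diff: "f a field_differentiable at w" if "a \<in> S" for a
    proof (rule holomorphic_on_imp_differentiable_at[OF hol[OF that] \<open>open A\<close>])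
      have "w \<in> cball w r"
        using r by simp
      then show "w \<in> A"
        using sub R by blast
    qed
    have "norm ((deriv ^^ 1) (\<lambda>u. f s u - f t u) w) \<le> fact 1 * (e / 2 * r) / r ^ 1"
    proof (rule Cauchy_inequality[OF _ _ r])
      show "(\<lambda>u. f s u - f t u) holomorphic_on ball w r"
        by (intro holomorphic_intros holomorphic_on_subset[OF hol_w] s t) auto
      show "continuous_on (cball w r) (\<lambda>u. f s u - f t u)"
        by (intro continuous_intros holomorphic_on_imp_continuous_on hol_w s t)
      fix u assume "norm (w - u) = r"
      then have "u \<in> cball z R"
        using sub by (auto simp: dist_norm)
      then show "norm (f s u - f t u) \<le> e / 2 * r"
        using near s by (auto simp: dist_norm)
    qed
    then have "dist (deriv (f s) w) (deriv (f t) w) \<le> e / 2"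
      using r diff s t by (simp add: dist_norm)
    moreover have "dist (deriv (f t) w) (deriv (f t) z) < e / 2"
      using w by (intro k) (auto simp: dist_commute)
    ultimately show ?thesis
      using dist_triangle[of "deriv (f s) w" "deriv (f t) z" "deriv (f t) w"] by linarith
  qed
  then show "\<forall>\<^sub>F x in at (t, z) within S \<times> A.
      dist (case x of (t, z) \<Rightarrow> deriv (f t) z) (deriv (f t) z) < e"
    unfolding eventually_at_topological using X r k
    by (intro exI[of _ "X \<times> ball z (min r k)"]) (auto intro!: open_Times)
qed

text \<open>
  The reverse flow is the characteristic of the Loewner equation through \<open>(T, h(0))\<close>, so
  \<open>f(T - s, h(s))\<close> is constant.  The chain rule in \<open>(t, z)\<close> requires \<open>f\<close> to be totally
  differentiable, which follows from joint continuity of the complex derivative.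
\<close>

lemma radial_Loewner_pair_eq_reverse_flow:
  assumes pair: "radial_Loewner_pair f W" and "T \<ge> 0"
    and h: "\<And>s. s \<in> {0..T} \<Longrightarrow>
      (h has_vector_derivative loewner_field (W (T - s)) (h s)) (at s within {0..T})"
    and h_ball: "\<And>s. s \<in> {0..T} \<Longrightarrow> norm (h s) < 1"
  shows "f T (h 0) = h T"
proof -
  define Q where "Q = {0::real..} \<times> ball (0::complex) 1"
  have hol: "\<And>t. t \<ge> 0 \<Longrightarrow> f t holomorphic_on ball 0 1"
    and f0: "\<And>z. z \<in> ball 0 1 \<Longrightarrow> f 0 z = z"
    and contf: "continuous_on Q (\<lambda>(t, z). f t z)"
    and ft: "\<And>t z. t \<ge> 0 \<Longrightarrow> z \<in> ball 0 1 \<Longrightarrow> ((\<lambda>s. f s z) has_vector_derivative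
           deriv (f t) z * loewner_field (W t) z) (at t within {0..})"
    using pair by (auto simp: radial_Loewner_pair_def loewner_field_def Q_def mult_ac)
  have contD: "continuous_on Q (\<lambda>(t, z). deriv (f t) z)"
    using contf hol unfolding Q_def by (intro continuous_on_deriv_parametric) auto
  have D: "((\<lambda>(t, z). f t z) has_derivative
      (\<lambda>(a, b). a *\<^sub>R (deriv (f t) z * loewner_field (W t) z) + deriv (f t) z * b)) (at (t, z) within Q)"
    if t: "t \<ge> 0" and z: "z \<in> ball 0 1" for t z
  proof -
    have "((\<lambda>(t, z). f t z) has_derivative
      (\<lambda>(a, b). a *\<^sub>R (deriv (f t) z * loewner_field (W t) z) + blinfun_mult_right (deriv (f t) z) b))
      (at (t, z) within Q)"
      unfolding Q_def
    proof (rule has_derivative_partialsI)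
      show "((\<lambda>s. f s z) has_derivative (\<lambda>a. a *\<^sub>R (deriv (f t) z * loewner_field (W t) z)))
          (at t within {0..})"
        using ft[OF t z] by (simp add: has_vector_derivative_def)
      fix s :: real and w :: complex assume sw: "s \<in> {0..}" "w \<in> ball 0 1"
      then have "(f s has_field_derivative deriv (f s) w) (at w within ball 0 1)"
        by (intro holomorphic_derivI[OF hol]) auto
      then show "(f s has_derivative blinfun_mult_right (deriv (f s) w)) (at w within ball 0 1)"
        by (simp add: has_field_derivative_def blinfun_mult_right.rep_eq)
    next
      have "continuous_on Q (\<lambda>p. blinfun_mult_right (case p of (t, z) \<Rightarrow> deriv (f t) z))"
        by (intro bounded_linear.continuous_on[OF bounded_linear_blinfun_mult_right] contD)
      then show "continuous (at (t, z) within {0..} \<times> ball 0 1) (\<lambda>(s, w). blinfun_mult_right (deriv (f s) w))"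
        using t z by (simp add: Q_def continuous_on_eq_continuous_within case_prod_unfold)
    qed (use z in auto)
    then show ?thesis
      by (simp add: blinfun_mult_right.rep_eq)
  qed
  define g where "g s = f (T - s) (h s)" for s
  have "(g has_derivative (\<lambda>_. 0)) (at s within {0..T})" if s: "s \<in> {0..T}" for s
  proof -
    have path: "((\<lambda>s. (T - s, h s)) has_derivative
        (\<lambda>d. (- d, d *\<^sub>R loewner_field (W (T - s)) (h s)))) (at s within {0..T})"
      using h[OF s] unfolding has_vector_derivative_def
      by (auto intro!: derivative_eq_intros)
    have "((\<lambda>s. (\<lambda>(t, z). f t z) (T - s, h s)) has_derivative
      (\<lambda>d. (\<lambda>(t, z). \<lambda>(a, b). a *\<^sub>R (deriv (f t) z * loewner_field (W t) z) + deriv (f t) z * b)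
        (T - s, h s) (- d, d *\<^sub>R loewner_field (W (T - s)) (h s)))) (at s within {0..T})"
      by (rule has_derivative_in_compose2[where t = Q, OF _ _ s path])
        (use D h_ball in \<open>auto simp: Q_def\<close>)
    then show ?thesis
      by (simp add: g_def[abs_def])
  qed
  then have "g T = g 0"
    using assms(2) by (intro has_derivative_zero_unique[of "{0..T}"]) auto
  then show ?thesis
    using assms(2) h_ball[of T] by (simp add: g_def f0)
qed

section \<open>Stability\<close>

text \<open>
  The logarithm of \<open>(\<bar>h\<^sub>1 - h\<^sub>2\<bar> + \<epsilon>) / sqrt ((1 - \<bar>h\<^sub>1\<bar>\<^sup>2) (1 - \<bar>h\<^sub>2\<bar>\<^sup>2))\<close> is nonincreasing, because the
  growth rate \<open>q\<^sub>1 + q\<^sub>2\<close> of the numerator is the logarithmic derivative of the denominator.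
\<close>

lemma loewner_flow_stability:
  assumes "T \<ge> 0" "\<epsilon> \<ge> 0"
    and V\<^sub>1: "\<And>s. s \<in> {0..T} \<Longrightarrow> norm (V\<^sub>1 s) = 1"
    and V\<^sub>2: "\<And>s. s \<in> {0..T} \<Longrightarrow> norm (V\<^sub>2 s) = 1"
    and V\<^sub>1\<^sub>2: "\<And>s. s \<in> {0..T} \<Longrightarrow> norm (V\<^sub>1 s - V\<^sub>2 s) \<le> \<epsilon>"
    and h\<^sub>1: "\<And>s. s \<in> {0..T} \<Longrightarrow>
      (h\<^sub>1 has_vector_derivative loewner_field (V\<^sub>1 s) (h\<^sub>1 s)) (at s within {0..T})"
    and h\<^sub>2: "\<And>s. s \<in> {0..T} \<Longrightarrow>
      (h\<^sub>2 has_vector_derivative loewner_field (V\<^sub>2 s) (h\<^sub>2 s)) (at s within {0..T})"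
    and b\<^sub>1: "\<And>s. s \<in> {0..T} \<Longrightarrow> norm (h\<^sub>1 s) < 1"
    and b\<^sub>2: "\<And>s. s \<in> {0..T} \<Longrightarrow> norm (h\<^sub>2 s) < 1"
  shows "(norm (h\<^sub>1 T - h\<^sub>2 T) + \<epsilon>) * sqrt ((1 - (norm (h\<^sub>1 0))\<^sup>2) * (1 - (norm (h\<^sub>2 0))\<^sup>2)) \<le>
    (norm (h\<^sub>1 0 - h\<^sub>2 0) + \<epsilon>) * sqrt ((1 - (norm (h\<^sub>1 T))\<^sup>2) * (1 - (norm (h\<^sub>2 T))\<^sup>2))"
proof -
  define D\<^sub>1 D\<^sub>2 P where "D\<^sub>1 s = 1 - (norm (h\<^sub>1 s))\<^sup>2" and "D\<^sub>2 s = 1 - (norm (h\<^sub>2 s))\<^sup>2"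
    and "P s = sqrt (D\<^sub>1 s * D\<^sub>2 s)" for s
  define q\<^sub>1 q\<^sub>2 where "q\<^sub>1 s = (norm (h\<^sub>1 s))\<^sup>2 / (norm (V\<^sub>1 s - h\<^sub>1 s))\<^sup>2"
    and "q\<^sub>2 s = (norm (h\<^sub>2 s))\<^sup>2 / (norm (V\<^sub>2 s - h\<^sub>2 s))\<^sup>2" for s
  have D_pos: "D\<^sub>1 s > 0" "D\<^sub>2 s > 0" if "s \<in> {0..T}" for s
    using b\<^sub>1[OF that] b\<^sub>2[OF that] by (auto simp: D\<^sub>1_def D\<^sub>2_def power_less_one_iff)
  have P_pos: "P s > 0" if "s \<in> {0..T}" for s
    using D_pos[OF that] by (simp add: P_def)
  have P_le: "P T \<le> 1"
    using D_pos[of T] assms(1) by (auto simp: P_def D\<^sub>1_def D\<^sub>2_def intro!: mult_le_one)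
  have lnD\<^sub>1: "((\<lambda>s. ln (D\<^sub>1 s)) has_real_derivative 2 * q\<^sub>1 s) (at s within {0..T})"
    if s: "s \<in> {0..T}" for s
    unfolding D\<^sub>1_def q\<^sub>1_def
    by (rule has_real_derivative_ln_gap_loewner_flow[OF h\<^sub>1[OF s] V\<^sub>1[OF s] b\<^sub>1[OF s]])
  have lnD\<^sub>2: "((\<lambda>s. ln (D\<^sub>2 s)) has_real_derivative 2 * q\<^sub>2 s) (at s within {0..T})"
    if s: "s \<in> {0..T}" for s
    unfolding D\<^sub>2_def q\<^sub>2_def
    by (rule has_real_derivative_ln_gap_loewner_flow[OF h\<^sub>2[OF s] V\<^sub>2[OF s] b\<^sub>2[OF s]])
  \<comment> \<open>The modulus is not differentiable where the two flows meet, so it is replaced by a smooth majorant \<open>\<phi>\<close> that exceeds it by at most \<open>\<delta>\<close>.\<close>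
  have reg: "(norm (h\<^sub>1 T - h\<^sub>2 T) + \<epsilon>) * P 0 \<le> (norm (h\<^sub>1 0 - h\<^sub>2 0) + \<epsilon>) * P T + \<delta>"
    if \<delta>: "\<delta> > 0" for \<delta>
  proof -
    define \<phi> where "\<phi> s = sqrt ((norm (h\<^sub>1 s - h\<^sub>2 s))\<^sup>2 + \<delta>\<^sup>2)" for s
    define I where "I s = inner (h\<^sub>1 s - h\<^sub>2 s) (loewner_field (V\<^sub>1 s) (h\<^sub>1 s) - loewner_field (V\<^sub>2 s) (h\<^sub>2 s))" for s
    have \<phi>_pos: "\<phi> s > 0" for s
      using \<delta> by (simp add: \<phi>_def add_nonneg_pos)
    have \<phi>_ge: "norm (h\<^sub>1 s - h\<^sub>2 s) \<le> \<phi> s" for s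
      by (simp add: \<phi>_def)
    have \<phi>': "(\<phi> has_real_derivative I s / \<phi> s) (at s within {0..T})" if s: "s \<in> {0..T}" for s
    proof -
      have pos: "(norm (h\<^sub>1 s - h\<^sub>2 s))\<^sup>2 + \<delta>\<^sup>2 > 0"
        using \<delta> by (simp add: add_nonneg_pos)
      have "((\<lambda>s. (norm (h\<^sub>1 s - h\<^sub>2 s))\<^sup>2 + \<delta>\<^sup>2) has_real_derivative 2 * I s + 0) (at s within {0..T})"
        unfolding I_def
        by (intro DERIV_add DERIV_const has_real_derivative_norm_power2
            has_vector_derivative_diff h\<^sub>1[OF s] h\<^sub>2[OF s])
      from DERIV_chain2[OF DERIV_real_sqrt[OF pos] this] show ?thesis
        unfolding \<phi>_def by (rule DERIV_cong) (simp add: field_simps)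
    qed
    define \<Lambda> where "\<Lambda> s = ln (\<phi> s + \<epsilon>) - (ln (D\<^sub>1 s) + ln (D\<^sub>2 s)) / 2" for s
    have \<Lambda>_eq: "\<Lambda> s = ln ((\<phi> s + \<epsilon>) / P s)" if "s \<in> {0..T}" for s
      using D_pos[OF that] \<phi>_pos[of s] assms(2) P_pos[OF that]
      by (simp add: \<Lambda>_def P_def ln_div ln_sqrt ln_mult add_pos_nonneg)
    have "\<Lambda> T \<le> \<Lambda> 0"
    proof (rule antimono_of_nonpos_derivative[OF assms(1)])
      fix s assume s: "s \<in> {0..T}"
      show "(\<Lambda> has_real_derivative (I s / \<phi> s) / (\<phi> s + \<epsilon>) - (q\<^sub>1 s + q\<^sub>2 s)) (at s within {0..T})"
      proof -
        have pos: "\<phi> s + \<epsilon> > 0"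
          using \<phi>_pos[of s] assms(2) by simp
        have simplify: "inverse a * (b + 0) - (2 * x + 2 * y) / 2 = b / a - (x + y)" for a b x y :: real
          by (simp add: field_simps)
        have "((\<lambda>s. \<phi> s + \<epsilon>) has_real_derivative I s / \<phi> s + 0) (at s within {0..T})"
          by (rule DERIV_add[OF \<phi>'[OF s] DERIV_const])
        from DERIV_diff[OF DERIV_chain2[OF DERIV_ln[OF pos] this]
            DERIV_cdivide[OF DERIV_add[OF lnD\<^sub>1[OF s] lnD\<^sub>2[OF s]], of 2]]
        show ?thesis
          unfolding \<Lambda>_def by (rule DERIV_cong) (rule simplify)
      qed
      have "I s \<le> norm (h\<^sub>1 s - h\<^sub>2 s) * (norm (h\<^sub>1 s - h\<^sub>2 s) + \<epsilon>) * (q\<^sub>1 s + q\<^sub>2 s)"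
        unfolding I_def q\<^sub>1_def q\<^sub>2_def
        by (rule inner_loewner_field_diff_le[OF V\<^sub>1[OF s] V\<^sub>2[OF s] b\<^sub>1[OF s] b\<^sub>2[OF s] V\<^sub>1\<^sub>2[OF s]])
      also have "\<dots> \<le> \<phi> s * (\<phi> s + \<epsilon>) * (q\<^sub>1 s + q\<^sub>2 s)"
        using \<phi>_pos[of s] \<phi>_ge[of s] assms(2) by (intro mult_mono) (auto simp: q\<^sub>1_def q\<^sub>2_def)
      finally show "(I s / \<phi> s) / (\<phi> s + \<epsilon>) - (q\<^sub>1 s + q\<^sub>2 s) \<le> 0"
        using \<phi>_pos[of s] assms(2) by (simp add: pos_divide_le_eq add_pos_nonneg mult_ac)
    qed
    then have "(\<phi> T + \<epsilon>) / P T \<le> (\<phi> 0 + \<epsilon>) / P 0"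
      using \<phi>_pos[of 0] \<phi>_pos[of T] P_pos[of 0] P_pos[of T] assms(1,2)
      by (simp add: \<Lambda>_eq add_pos_nonneg)
    then have "(\<phi> T + \<epsilon>) * P 0 \<le> (\<phi> 0 + \<epsilon>) * P T"
      using P_pos[of 0] P_pos[of T] assms(1) by (simp add: field_simps)
    moreover have "(norm (h\<^sub>1 T - h\<^sub>2 T) + \<epsilon>) * P 0 \<le> (\<phi> T + \<epsilon>) * P 0"
      using \<phi>_ge[of T] P_pos[of 0] assms(1) by (intro mult_right_mono) auto
    moreover have "\<phi> 0 \<le> norm (h\<^sub>1 0 - h\<^sub>2 0) + \<delta>"
      using sqrt_sum_squares_le_sum[of "norm (h\<^sub>1 0 - h\<^sub>2 0)" \<delta>] \<delta> by (simp add: \<phi>_def)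
    then have "(\<phi> 0 + \<epsilon>) * P T \<le> (norm (h\<^sub>1 0 - h\<^sub>2 0) + \<delta> + \<epsilon>) * P T"
      using P_pos[of T] assms(1) by (intro mult_right_mono) auto
    moreover have "\<delta> * P T \<le> \<delta>"
      using \<delta> P_le by (simp add: mult_left_le)
    ultimately show ?thesis
      by (simp add: algebra_simps)
  qed
  show ?thesis
    using field_le_epsilon[OF reg] by (simp add: P_def D\<^sub>1_def D\<^sub>2_def)
qed

lemma radial_Loewner_pair_stability:
  assumes p\<^sub>1: "radial_Loewner_pair f\<^sub>1 W\<^sub>1" and p\<^sub>2: "radial_Loewner_pair f\<^sub>2 W\<^sub>2" and "T \<ge> 0" "\<epsilon> \<ge> 0"
    and W\<^sub>1\<^sub>2: "\<And>t. t \<in> {0..T} \<Longrightarrow> norm (W\<^sub>1 t - W\<^sub>2 t) \<le> \<epsilon>"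
    and z: "norm z\<^sub>1 < 1" "norm z\<^sub>2 < 1"
  shows "(norm (f\<^sub>1 T z\<^sub>1 - f\<^sub>2 T z\<^sub>2) + \<epsilon>) * sqrt ((1 - (norm z\<^sub>1)\<^sup>2) * (1 - (norm z\<^sub>2)\<^sup>2)) \<le>
    norm (z\<^sub>1 - z\<^sub>2) + \<epsilon>"
proof -
  have flow: "\<exists>h. h 0 = z \<and> f T z = h T \<and> (\<forall>s\<in>{0..T}. norm (W (T - s)) = 1 \<and> norm (h s) < 1 \<and>
      (h has_vector_derivative loewner_field (W (T - s)) (h s)) (at s within {0..T}))"
    if p: "radial_Loewner_pair f W" and z: "norm z < 1" for f W z
  proof -
    have W: "continuous_on {0..} W" "W ` {0..} \<subseteq> sphere 0 1"
      using p by (auto simp: radial_Loewner_pair_def)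
    have "continuous_on {0..T} (\<lambda>s. W (T - s))"
      by (intro continuous_on_compose2[OF W(1)] continuous_intros) auto
    moreover have norm_W: "norm (W (T - s)) = 1" if "s \<in> {0..T}" for s
    proof -
      have "W (T - s) \<in> sphere 0 1"
        by (rule subsetD[OF W(2)]) (use that in auto)
      then show ?thesis
        by simp
    qed
    ultimately obtain h where "h 0 = z" "\<And>s. s \<in> {0..T} \<Longrightarrow> norm (h s) < 1"
      "\<And>s. s \<in> {0..T} \<Longrightarrow>
        (h has_vector_derivative loewner_field (W (T - s)) (h s)) (at s within {0..T})"
      using reverse_flow_exists[of T "\<lambda>s. W (T - s)" z] \<open>T \<ge> 0\<close> z by blast
    then show ?thesis
      using radial_Loewner_pair_eq_reverse_flow[OF p \<open>T \<ge> 0\<close>, of h] norm_W by blast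
  qed
  obtain h\<^sub>1 where h\<^sub>1: "h\<^sub>1 0 = z\<^sub>1" "f\<^sub>1 T z\<^sub>1 = h\<^sub>1 T" "\<forall>s\<in>{0..T}. norm (W\<^sub>1 (T - s)) = 1 \<and> norm (h\<^sub>1 s) < 1 \<and>
      (h\<^sub>1 has_vector_derivative loewner_field (W\<^sub>1 (T - s)) (h\<^sub>1 s)) (at s within {0..T})"
    using flow[OF p\<^sub>1 z(1)] by blast
  obtain h\<^sub>2 where h\<^sub>2: "h\<^sub>2 0 = z\<^sub>2" "f\<^sub>2 T z\<^sub>2 = h\<^sub>2 T" "\<forall>s\<in>{0..T}. norm (W\<^sub>2 (T - s)) = 1 \<and> norm (h\<^sub>2 s) < 1 \<and>
      (h\<^sub>2 has_vector_derivative loewner_field (W\<^sub>2 (T - s)) (h\<^sub>2 s)) (at s within {0..T})"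
    using flow[OF p\<^sub>2 z(2)] by blast
  have "(norm (h\<^sub>1 T - h\<^sub>2 T) + \<epsilon>) * sqrt ((1 - (norm (h\<^sub>1 0))\<^sup>2) * (1 - (norm (h\<^sub>2 0))\<^sup>2)) \<le>
    (norm (h\<^sub>1 0 - h\<^sub>2 0) + \<epsilon>) * sqrt ((1 - (norm (h\<^sub>1 T))\<^sup>2) * (1 - (norm (h\<^sub>2 T))\<^sup>2))"
    by (rule loewner_flow_stability[where V\<^sub>1 = "\<lambda>s. W\<^sub>1 (T - s)" and V\<^sub>2 = "\<lambda>s. W\<^sub>2 (T - s)"])
      (use h\<^sub>1 h\<^sub>2 W\<^sub>1\<^sub>2 assms(3,4) in auto)
  also have "\<dots> \<le> norm (h\<^sub>1 0 - h\<^sub>2 0) + \<epsilon>"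
  proof (rule mult_left_le)
    have "norm (h\<^sub>1 T) < 1" "norm (h\<^sub>2 T) < 1"
      using h\<^sub>1(3) h\<^sub>2(3) assms(3) by auto
    then show "sqrt ((1 - (norm (h\<^sub>1 T))\<^sup>2) * (1 - (norm (h\<^sub>2 T))\<^sup>2)) \<le> 1"
      by (auto intro!: mult_le_one simp: power_le_one)
  qed (use assms(4) in auto)
  finally show ?thesis
    by (simp add: h\<^sub>1(1,2) h\<^sub>2(1,2))
qed

theorem proposition2p3:
  fixes \<rho> :: real
  assumes "\<rho> > 1"
  shows "\<exists>\<epsilon>\<^sub>0 d\<^sub>0 c :: real. \<epsilon>\<^sub>0 > 0 \<and> d\<^sub>0 > 0 \<and>
    (\<forall>f\<^sub>1 W\<^sub>1 f\<^sub>2 W\<^sub>2 T \<epsilon>.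
       radial_Loewner_pair f\<^sub>1 W\<^sub>1 \<longrightarrow> radial_Loewner_pair f\<^sub>2 W\<^sub>2 \<longrightarrow>
       T \<ge> 0 \<longrightarrow> (SUP t\<in>{0..T}. cmod (W\<^sub>1 t - W\<^sub>2 t)) \<le> \<epsilon> \<longrightarrow> \<epsilon> < \<epsilon>\<^sub>0 \<longrightarrow>
       (\<forall>d z\<^sub>1 z\<^sub>2.
          z\<^sub>1 \<in> ball 0 1 \<longrightarrow> z\<^sub>2 \<in> ball 0 1 \<longrightarrow> cmod (z\<^sub>1 - z\<^sub>2) \<le> \<epsilon> \<longrightarrow>
          cmod z\<^sub>1 \<le> 1 - d \<longrightarrow> cmod z\<^sub>2 \<le> 1 - d \<longrightarrow>
          (4 * \<epsilon>) powr (1 / \<rho>) \<le> d \<longrightarrow> d \<le> d\<^sub>0 \<longrightarrow>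
          cmod (f\<^sub>1 T z\<^sub>1 - f\<^sub>2 T z\<^sub>2) \<le> c * \<epsilon> * d powr (- \<rho>)))"
proof -
  have main: "cmod (f\<^sub>1 T z\<^sub>1 - f\<^sub>2 T z\<^sub>2) \<le> 2 * \<epsilon> * d powr (- \<rho>)"
    if p\<^sub>1: "radial_Loewner_pair f\<^sub>1 W\<^sub>1" and p\<^sub>2: "radial_Loewner_pair f\<^sub>2 W\<^sub>2" and T: "T \<ge> 0"
      and sup: "(SUP t\<in>{0..T}. cmod (W\<^sub>1 t - W\<^sub>2 t)) \<le> \<epsilon>"
      and z: "z\<^sub>1 \<in> ball 0 1" "z\<^sub>2 \<in> ball 0 1" "cmod (z\<^sub>1 - z\<^sub>2) \<le> \<epsilon>" "cmod z\<^sub>1 \<le> 1 - d" "cmod z\<^sub>2 \<le> 1 - d"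
      and d: "(4 * \<epsilon>) powr (1 / \<rho>) \<le> d" "d \<le> 1"
    for f\<^sub>1 W\<^sub>1 f\<^sub>2 W\<^sub>2 T \<epsilon> d z\<^sub>1 z\<^sub>2
  proof -
    define S where "S = sqrt ((1 - (norm z\<^sub>1)\<^sup>2) * (1 - (norm z\<^sub>2)\<^sup>2))"
    have \<epsilon>: "\<epsilon> \<ge> 0"
      using z(3) norm_ge_zero order_trans by blast
    have "continuous_on {0..T} W\<^sub>1" "continuous_on {0..T} W\<^sub>2"
      using p\<^sub>1 p\<^sub>2 unfolding radial_Loewner_pair_def
      by (auto elim!: continuous_on_subset)
    then have "compact ((\<lambda>t. cmod (W\<^sub>1 t - W\<^sub>2 t)) ` {0..T})"
      by (intro compact_continuous_image continuous_intros) auto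
    then have bdd: "bdd_above ((\<lambda>t. cmod (W\<^sub>1 t - W\<^sub>2 t)) ` {0..T})"
      by (intro bounded_imp_bdd_above compact_imp_bounded)
    have W: "norm (W\<^sub>1 t - W\<^sub>2 t) \<le> \<epsilon>" if "t \<in> {0..T}" for t
      using cSUP_upper[OF that bdd] sup by linarith
    have stab: "(cmod (f\<^sub>1 T z\<^sub>1 - f\<^sub>2 T z\<^sub>2) + \<epsilon>) * S \<le> 2 * \<epsilon>"
      using radial_Loewner_pair_stability[OF p\<^sub>1 p\<^sub>2 T \<epsilon> W, of z\<^sub>1 z\<^sub>2] z unfolding S_def by auto
    have d0: "d \<ge> 0"
      using d(1) powr_ge_zero order_trans by blast
    have S_pos: "S > 0"
      using z(1,2) by (simp add: S_def power_less_one_iff)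
    show ?thesis
    \<comment> \<open>Only for \<open>\<epsilon> = 0\<close> can \<open>d\<close> vanish, and there \<open>0 powr (- \<rho>) = 0\<close>; but then the two images coincide.\<close>
    proof (cases "\<epsilon> = 0")
      case True
      then show ?thesis
        using stab S_pos by (simp add: mult_le_0_iff)
    next
      case False
      then have "(4 * \<epsilon>) powr (1 / \<rho>) > 0"
        using \<epsilon> by simp
      then have d_pos: "d > 0"
        using d(1) by linarith
      have D: "d \<le> 1 - (norm z)\<^sup>2" if "norm z \<le> 1 - d" for z :: complex
        using that d_pos power_le_one[of "norm z" 2] mult_left_le[of "norm z" "norm z"]
        by (simp add: power2_eq_square)
      have "sqrt (d * d) \<le> S"
        unfolding S_def using D[OF z(4)] D[OF z(5)] d0 by (intro real_sqrt_le_mono mult_mono) auto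
      then have "d \<le> S"
        using d0 by simp
      then have "(cmod (f\<^sub>1 T z\<^sub>1 - f\<^sub>2 T z\<^sub>2) + \<epsilon>) * d \<le> 2 * \<epsilon>"
        using stab \<epsilon> by (meson add_nonneg_nonneg mult_left_mono norm_ge_zero order_trans)
      then have "cmod (f\<^sub>1 T z\<^sub>1 - f\<^sub>2 T z\<^sub>2) \<le> 2 * \<epsilon> * d powr (- 1)"
        using d_pos \<epsilon> by (simp add: powr_minus field_simps) (smt (verit) mult_nonneg_nonneg)
      also have "\<dots> \<le> 2 * \<epsilon> * d powr (- \<rho>)"
        using d_pos d(2) \<epsilon> assms by (intro mult_left_mono powr_mono') auto
      finally show ?thesis .
    qed
  qed
  show ?thesis
    by (rule exI[of _ 1], rule exI[of _ 1], rule exI[of _ 2], intro conjI allI impI zero_less_one)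
      (rule main; assumption)
qed

end
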